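(* Let $(\mathcal{B},\phi,\rho)$ be an overlapping substitution in $\mathbb{R}^d$ with expansion constant $\beta$, i.e. $\phi(x)=\beta x$ for a real number $\beta$ with $|\beta|>1$, and let $\mathcal{T}$ be a tiling of $\mathbb{R}^d$ by translates of elements of $\mathcal{B}$ with $\rho(\mathcal{T})=\mathcal{T}$. If $\mathcal{T}$ has finite local complexity and is repetitive, then $\beta$ is an algebraic integer.
   Context: Tiles. A tile in $\mathbb{R}^d$ is either a nonempty compact set $S\subset\mathbb{R}^d$ with $S=\overline{S^\circ}$, or a pair $T=(S,l)$ of such a set with a label $l$ from a finite set; $\operatorname{supp}T=S$, $\operatorname{int}T=S^\circ$, and $T+x=(S+x,l)$. A pattern is a set of tiles; a patch is a pattern in which $T_1\ne T_2$ implies $\operatorname{int}T_1\cap\operatorname{int}T_2=\emptyset$. The support of a patch is the union of the supports of its tiles; a tiling is a patch with support $\mathbb{R}^d$. Overlapping substitutions. A pre-overlapping substitution is a triple $(\mathcal{B},\phi,\rho)$ where $\mathcal{B}=\{T_1,\dots,T_\kappa\}$ is a finite set of tiles (proto-tiles), no two of which are translates of each other, $\phi:\mathbb{R}^d\to\mathbb{R}^d$ is a linear map all of whose eigenvalues have modulus $>1$, and $\rho$ assigns to each $T_i$ a finite (nonempty) patch $\rho(T_i)$ of translates of elements of $\mathcal{B}$. Put $\rho(T_i+x)=\rho(T_i)+\phi(x)$ and $\rho(\mathcal{P})=\bigcup_{T\in\mathcal{P}}\rho(T)$ for a pattern $\mathcal{P}$ of translates of proto-tiles. It is called an overlapping substitution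 (consistent) if $\rho^n(\{T_i\})$ is a patch for all $n>0$ and all $i$. Finite local complexity: for every $R>0$ there are, up to translation, only finitely many patches of $\mathcal{T}$ that appear in a ball of radius $R$. Repetitive: for every finite patch $\mathcal{P}\subset\mathcal{T}$ there is $R>0$ such that every ball of radius $R$ contains (the support of) a translate of $\mathcal{P}$ included in $\mathcal{T}$. *)

theory Defs
  imports "HOL-Analysis.Analysis" "HOL-Computational_Algebra.Computational_Algebra"
begin

datatype ('a, 'l) tile =
    Unlabelled (supp: "'a set")
  | Labelled (supp: "'a set") 'l

definition is_tile :: "(real^'d, 'l) tile \<Rightarrow> bool" where
  "is_tile T \<longleftrightarrow> supp T \<noteq> {} \<and> compact (supp T) \<and> supp T = closure (interior (supp T))"

fun translate :: "real^'d \<Rightarrow> (real^'d, 'l) tile \<Rightarrow> (real^'d, 'l) tile" where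
  "translate x (Unlabelled S) = Unlabelled ((\<lambda>y. y + x) ` S)"
| "translate x (Labelled S l) = Labelled ((\<lambda>y. y + x) ` S) l"

definition is_patch :: "(real^'d, 'l) tile set \<Rightarrow> bool" where
  "is_patch P \<longleftrightarrow> (\<forall>T\<in>P. is_tile T) \<and>
     (\<forall>T1\<in>P. \<forall>T2\<in>P. T1 \<noteq> T2 \<longrightarrow> interior (supp T1) \<inter> interior (supp T2) = {})"

definition pattern_supp :: "(real^'d, 'l) tile set \<Rightarrow> (real^'d) set" where
  "pattern_supp P = (\<Union>T\<in>P. supp T)"

definition is_tiling :: "(real^'d, 'l) tile set \<Rightarrow> bool" where
  "is_tiling P \<longleftrightarrow> is_patch P \<and> pattern_supp P = UNIV"

definition translates_of :: "(real^'d, 'l) tile set \<Rightarrow> (real^'d, 'l) tile set" where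
  "translates_of B = {translate x T | x T. T \<in> B}"

text \<open>Eigenvalues are complex: they are those of the complexified matrix of the map.\<close>

definition complex_eigenvalue :: "(real^'d \<Rightarrow> real^'d) \<Rightarrow> complex \<Rightarrow> bool" where
  "complex_eigenvalue \<phi> \<mu> \<longleftrightarrow>
     (\<exists>v :: complex^'d. v \<noteq> 0 \<and> (\<chi> i j. complex_of_real (matrix \<phi> $ i $ j)) *v v = \<mu> *s v)"

definition pre_overlapping_substitution ::
  "(real^'d, 'l) tile set \<Rightarrow> (real^'d \<Rightarrow> real^'d) \<Rightarrow>
   ((real^'d, 'l) tile \<Rightarrow> (real^'d, 'l) tile set) \<Rightarrow> bool" where
  "pre_overlapping_substitution B \<phi> \<rho> \<longleftrightarrow>
     finite B \<and> (\<forall>T\<in>B. is_tile T) \<and>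
     (\<forall>T1\<in>B. \<forall>T2\<in>B. T1 \<noteq> T2 \<longrightarrow> (\<forall>x. T2 \<noteq> translate x T1)) \<and>
     linear \<phi> \<and> (\<forall>\<mu>. complex_eigenvalue \<phi> \<mu> \<longrightarrow> cmod \<mu> > 1) \<and>
     (\<forall>T\<in>B. finite (\<rho> T) \<and> \<rho> T \<noteq> {} \<and> is_patch (\<rho> T) \<and> \<rho> T \<subseteq> translates_of B)"

text \<open>
  The extension of \<open>\<rho>\<close> to translates of proto-tiles, and to patterns of such translates.
  For a pre-overlapping substitution, the representation \<open>U = translate x T\<close> with \<open>T \<in> B\<close>
  is unique (tiles are nonempty and compact, and distinct proto-tiles are not translates
  of each other), so the union in \<open>subst_tile\<close> has a single member.
\<close>

definition subst_tile ::
  "(real^'d, 'l) tile set \<Rightarrow> (real^'d \<Rightarrow> real^'d) \<Rightarrow>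
   ((real^'d, 'l) tile \<Rightarrow> (real^'d, 'l) tile set) \<Rightarrow>
   (real^'d, 'l) tile \<Rightarrow> (real^'d, 'l) tile set" where
  "subst_tile B \<phi> \<rho> U = \<Union>{translate (\<phi> x) ` \<rho> T | x T. T \<in> B \<and> U = translate x T}"

definition subst_pattern ::
  "(real^'d, 'l) tile set \<Rightarrow> (real^'d \<Rightarrow> real^'d) \<Rightarrow>
   ((real^'d, 'l) tile \<Rightarrow> (real^'d, 'l) tile set) \<Rightarrow>
   (real^'d, 'l) tile set \<Rightarrow> (real^'d, 'l) tile set" where
  "subst_pattern B \<phi> \<rho> P = (\<Union>U\<in>P. subst_tile B \<phi> \<rho> U)"

definition overlapping_substitution ::
  "(real^'d, 'l) tile set \<Rightarrow> (real^'d \<Rightarrow> real^'d) \<Rightarrow>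
   ((real^'d, 'l) tile \<Rightarrow> (real^'d, 'l) tile set) \<Rightarrow> bool" where
  "overlapping_substitution B \<phi> \<rho> \<longleftrightarrow>
     pre_overlapping_substitution B \<phi> \<rho> \<and>
     (\<forall>n>0. \<forall>T\<in>B. is_patch ((subst_pattern B \<phi> \<rho> ^^ n) {T}))"

text \<open>A patch of \<open>\<T>\<close> appears in a ball if its support is contained in that ball.\<close>

definition finite_local_complexity :: "(real^'d, 'l) tile set \<Rightarrow> bool" where
  "finite_local_complexity \<T> \<longleftrightarrow>
     (\<forall>R>0. \<exists>F. finite F \<and>
        (\<forall>P c. P \<subseteq> \<T> \<and> pattern_supp P \<subseteq> ball c R \<longrightarrow> (\<exists>Q\<in>F. \<exists>x. P = translate x ` Q)))"

definition repetitive :: "(real^'d, 'l) tile set \<Rightarrow> bool" where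
  "repetitive \<T> \<longleftrightarrow>
     (\<forall>P. P \<subseteq> \<T> \<and> finite P \<longrightarrow>
        (\<exists>R>0. \<forall>c. \<exists>x. translate x ` P \<subseteq> \<T> \<and> pattern_supp (translate x ` P) \<subseteq> ball c R))"

end

theory Submission
  imports Defs "Jordan_Normal_Form.Char_Poly"
begin

text \<open>
  Choose one child of every proto-tile and attach a control point to every proto-tile so that
  the control point of the chosen child of a tile is \<open>\<beta>\<close> times the control point of the tile.
  Then multiplication by \<open>\<beta>\<close> preserves the group generated by all differences of control points
  of tiles of \<open>\<T>\<close>. Any two tiles are joined by a chain of tiles in which consecutive ones
  are close, so by finite local complexity this group is finitely generated. It is
  nonzero since \<open>\<T>\<close> is infinite, so it has a nonzero image under some linear functional,
  and \<open>\<beta>\<close> is an eigenvalue of an integer matrix.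
\<close>

section \<open>Finitely generated additive groups and algebraic integers\<close>

text \<open>For finite \<open>S\<close> this is the additive group generated by \<open>S\<close>;
  for infinite \<open>S\<close> the sums default to 0 and the span collapses to {0}.\<close>

definition int_span :: "'a::ring_1 set \<Rightarrow> 'a set" where
  "int_span S = range (\<lambda>m :: 'a \<Rightarrow> int. \<Sum>t\<in>S. of_int (m t) * t)"

lemma int_spanI: "(\<Sum>t\<in>S. of_int (m t) * t) \<in> int_span S"
  by (simp add: int_span_def)

lemma int_span_superset:
  assumes "finite S" "s \<in> S"
  shows "s \<in> int_span S"
proof -
  have "(\<Sum>t\<in>S. of_int (if t = s then 1 else 0) * t) = (\<Sum>t\<in>S. if t = s then t else 0)"
    by (intro sum.cong) auto
  also have "\<dots> = s"
    using assms by simp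
  finally show ?thesis
    using int_spanI[of "\<lambda>t. if t = s then 1 else 0" S] by metis
qed

lemma int_span_zero: "0 \<in> int_span S"
  using int_spanI[of "\<lambda>_. 0" S] by simp

lemma int_span_add:
  assumes "a \<in> int_span S" "b \<in> int_span S"
  shows "a + b \<in> int_span S"
proof -
  obtain m m' :: "'a \<Rightarrow> int" where "a = (\<Sum>t\<in>S. of_int (m t) * t)" "b = (\<Sum>t\<in>S. of_int (m' t) * t)"
    using assms unfolding int_span_def by blast
  then have "a + b = (\<Sum>t\<in>S. of_int (m t + m' t) * t)"
    by (simp add: sum.distrib ring_distribs)
  then show ?thesis
    using int_spanI[of "\<lambda>t. m t + m' t" S] by metis
qed

lemma int_span_subset_zero:
  assumes "S \<subseteq> {0}"
  shows "int_span S = {0}"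
proof -
  have "(\<Sum>t\<in>S. of_int (m t) * t) = 0" for m :: "'a \<Rightarrow> int"
    using assms by (intro sum.neutral) auto
  then show ?thesis
    by (auto simp: int_span_def)
qed

text \<open>Expressing each \<beta> * s in the generators gives an integer matrix that has the
  vector of all generators as an eigenvector for \<beta>. The generators may satisfy integer
  relations: it suffices that this vector is nonzero. The characteristic polynomial is then monic
  and integral with root \<beta>.\<close>

lemma algebraic_int_if_int_span_invariant:
  fixes S :: "'a::field_char_0 set"
  assumes fin: "finite S" and nz: "\<not> S \<subseteq> {0}"
    and inv: "\<And>s. s \<in> S \<Longrightarrow> \<beta> * s \<in> int_span S"
  shows "algebraic_int \<beta>"
proof -
  have "\<forall>s\<in>S. \<exists>m :: 'a \<Rightarrow> int. \<beta> * s = (\<Sum>t\<in>S. of_int (m t) * t)"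
    using inv unfolding int_span_def by blast
  then obtain m :: "'a \<Rightarrow> 'a \<Rightarrow> int" where m: "\<And>s. s \<in> S \<Longrightarrow> \<beta> * s = (\<Sum>t\<in>S. of_int (m s t) * t)"
    by metis
  obtain s0 where s0: "s0 \<in> S" "s0 \<noteq> 0"
    using nz by blast
  obtain xs where xs: "set xs = S" "distinct xs"
    using fin finite_distinct_list by blast
  define n where "n = length xs"
  define M where "M = Matrix.mat n n (\<lambda>(i, j). m (xs ! i) (xs ! j))"
  define w where "w = Matrix.vec n (\<lambda>i. xs ! i)"
  have M: "M \<in> carrier_mat n n"
    by (simp add: M_def)
  then have M': "map_mat (of_int :: int \<Rightarrow> 'a) M \<in> carrier_mat n n"
    by simp
  have "w \<noteq> 0\<^sub>v n"
  proof
    assume w0: "w = 0\<^sub>v n"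
    obtain i where i: "i < n" "xs ! i = s0"
      using s0(1) xs(1) by (metis in_set_conv_nth n_def)
    then have "vec_index w i = s0"
      by (simp add: w_def)
    with w0 i s0(2) show False
      by simp
  qed
  moreover have "map_mat of_int M *\<^sub>v w = \<beta> \<cdot>\<^sub>v w"
  proof (rule eq_vecI)
    fix i assume "i < dim_vec (\<beta> \<cdot>\<^sub>v w)"
    then have i: "i < n"
      by (simp add: w_def)
    then have "vec_index (map_mat of_int M *\<^sub>v w) i = (\<Sum>j<n. of_int (m (xs ! i) (xs ! j)) * xs ! j)"
      by (simp add: M_def w_def scalar_prod_def atLeast0LessThan)
    also have "\<dots> = (\<Sum>t\<in>S. of_int (m (xs ! i) t) * t)"
      by (rule sum.reindex_bij_betw[OF bij_betw_nth]) (use xs n_def in auto)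
    also have "\<dots> = \<beta> * xs ! i"
      using m i xs(1) by (auto simp: n_def)
    finally show "vec_index (map_mat of_int M *\<^sub>v w) i = vec_index (\<beta> \<cdot>\<^sub>v w) i"
      using i by (simp add: w_def)
  qed (simp add: M_def w_def)
  ultimately have "eigenvalue (map_mat of_int M) \<beta>"
    using M' unfolding eigenvalue_def eigenvector_def by (intro exI[of _ w]) (auto simp: M_def w_def)
  then have "poly (map_poly of_int (char_poly M)) \<beta> = 0"
    by (simp add: eigenvalue_root_char_poly[OF M'] of_int_hom.char_poly_hom[OF M])
  moreover have "lead_coeff (char_poly M) = 1"
    using degree_monic_char_poly[OF M] by simp
  ultimately show ?thesis
    unfolding algebraic_int_altdef_ipoly by blast
qed

section \<open>Translates of tiles and their relative positions\<close>

lemma supp_translate: "supp (translate x T) = (\<lambda>y. y + x) ` supp T"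
  by (cases T) auto

lemma translate_translate: "translate y (translate x T) = translate (x + y) T"
  by (cases T) (auto simp: image_image add.assoc)

lemma translate_zero: "translate 0 T = T"
  by (cases T) auto

text \<open>The shift v = y - x maps the nonempty compact support into itself. A point maximising
  the inner product with v is moved to one where it is larger by \<open>inner v v\<close>, so v =
  0.\<close>

lemma translate_inject:
  assumes T: "is_tile T" and eq: "translate x T = translate y T"
  shows "x = y"
proof -
  define v where "v = y - x"
  have S: "supp T \<noteq> {}" "compact (supp T)"
    using T by (auto simp: is_tile_def)
  have "(\<lambda>z. z + x) ` supp T = (\<lambda>z. z + y) ` supp T"
    using eq by (metis supp_translate)
  then have shift: "z + v \<in> supp T" if "z \<in> supp T" for z
  proof -
    have "z + y \<in> (\<lambda>z. z + x) ` supp T"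
      using that \<open>(\<lambda>z. z + x) ` supp T = (\<lambda>z. z + y) ` supp T\<close> by auto
    then obtain z' where "z' \<in> supp T" "z + y = z' + x"
      by blast
    moreover from this have "z + v = z'"
      by (simp add: v_def algebra_simps)
    ultimately show ?thesis
      by simp
  qed
  have "continuous_on (supp T) (\<lambda>z. inner z v)"
    by (intro continuous_intros)
  then obtain s where s: "s \<in> supp T" "\<And>z. z \<in> supp T \<Longrightarrow> inner z v \<le> inner s v"
    using continuous_attains_sup[OF S(2) S(1)] by blast
  have "inner (s + v) v \<le> inner s v"
    using s shift by blast
  then have "inner v v \<le> 0"
    by (simp add: inner_add_left)
  then have "v = 0"
    using inner_gt_zero_iff[of v] by linarith
  then show ?thesis
    by (simp add: v_def)
qed

text \<open>Pairing position with proto-tile lets a control point be computed directly from the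
  pair, without choosing a decomposition of the tile.\<close>

definition tile_reps :: "(real^'d, 'l) tile set \<Rightarrow> (real^'d, 'l) tile set \<Rightarrow> ((real^'d) \<times> (real^'d, 'l) tile) set" where
  "tile_reps B P = {(x, A). A \<in> B \<and> translate x A \<in> P}"

lemma finite_tile_reps:
  assumes "finite B" "\<And>A. A \<in> B \<Longrightarrow> is_tile A" "finite P"
  shows "finite (tile_reps B P)"
proof (rule finite_imageD)
  let ?g = "\<lambda>(x, A). (translate x A, A)"
  show "finite (?g ` tile_reps B P)"
    by (rule finite_subset[of _ "P \<times> B"]) (use assms in \<open>auto simp: tile_reps_def\<close>)
  show "inj_on ?g (tile_reps B P)"
    using assms(2) translate_inject by (fastforce simp: inj_on_def tile_reps_def)
qed

text \<open>Two tiles in a common ball form a patch there, hence a translate of one of finitely many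
  patterns. As x - y is invariant under translation, it can be read off that pattern.\<close>

lemma finite_relative_positions:
  assumes B: "finite B" "\<And>A. A \<in> B \<Longrightarrow> is_tile A"
    and flc: "finite_local_complexity \<T>" and R: "R > 0"
  shows "finite {(A, C, x - y) | x y A C. (x, A) \<in> tile_reps B \<T> \<and> (y, C) \<in> tile_reps B \<T> \<and>
    (\<exists>c. supp (translate x A) \<union> supp (translate y C) \<subseteq> ball c R)}" (is "finite ?D")
proof -
  obtain F where F: "finite F"
    "\<And>P c. P \<subseteq> \<T> \<Longrightarrow> pattern_supp P \<subseteq> ball c R \<Longrightarrow> \<exists>Q\<in>F. \<exists>x. P = translate x ` Q"
    using flc R unfolding finite_local_complexity_def by meson
  \<comment> \<open>\<open>F\<close> may contain infinite patterns; a representative of a two-tile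
    patch is finite, so discarding them loses nothing and makes \<open>G\<close> finite.\<close>
  define G where "G = (\<Union>Q\<in>{Q\<in>F. finite Q}. tile_reps B Q)"
  have "finite G"
    unfolding G_def using F(1) B by (auto intro: finite_tile_reps)
  have "?D \<subseteq> (\<lambda>((x, A), (y, C)). (A, C, x - y)) ` (G \<times> G)"
  proof
    fix t assume "t \<in> ?D"
    then obtain x y A C c where t: "t = (A, C, x - y)"
      and r: "(x, A) \<in> tile_reps B \<T>" "(y, C) \<in> tile_reps B \<T>"
      and c: "supp (translate x A) \<union> supp (translate y C) \<subseteq> ball c R"
      by blast
    define P where "P = {translate x A, translate y C}"
    have "P \<subseteq> \<T>" "pattern_supp P \<subseteq> ball c R"
      using r c by (auto simp: P_def tile_reps_def pattern_supp_def)
    then obtain Q z where Q: "Q \<in> F" "P = translate z ` Q"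
      using F(2) by meson
    then have Q_eq: "Q = translate (- z) ` P"
      by (simp add: image_image translate_translate translate_zero)
    then have "finite Q"
      by (simp add: P_def)
    moreover have "(x - z, A) \<in> tile_reps B Q" "(y - z, C) \<in> tile_reps B Q"
      using r unfolding Q_eq by (auto simp: P_def tile_reps_def translate_translate)
    ultimately have "(x - z, A) \<in> G" "(y - z, C) \<in> G"
      using Q(1) by (auto simp: G_def)
    then show "t \<in> (\<lambda>((x, A), (y, C)). (A, C, x - y)) ` (G \<times> G)"
      unfolding t by (intro image_eqI[of _ _ "((x - z, A), (y - z, C))"]) auto
  qed
  moreover have "finite ((\<lambda>((x, A), (y, C)). (A, C, x - y)) ` (G \<times> G))"
    using \<open>finite G\<close> by (intro finite_imageI finite_cartesian_product)
  ultimately show ?thesis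
    by (rule finite_subset)
qed

text \<open>Connectedness of the space replaces the explicit construction of chains of tiles:
  closure under steps shorter than 1 makes both the set and its complement open.\<close>

lemma ball_closed_set_eq_UNIV:
  fixes U :: "'a::real_normed_vector set"
  assumes "U \<noteq> {}" and step: "\<And>y z. y \<in> U \<Longrightarrow> dist y z < 1 \<Longrightarrow> z \<in> U"
  shows "U = UNIV"
proof -
  have "open U"
    unfolding open_dist using step by (auto simp: dist_commute intro!: exI[of _ 1])
  moreover have "open (- U)"
    unfolding open_dist using step by (auto intro!: exI[of _ 1])
  ultimately show ?thesis
    using assms(1) clopen[of U] by (simp add: closed_def)
qed

section \<open>Control points and the main argument\<close>

text \<open>The control points solve a fixed-point equation for a contraction; iterating it gives a
  geometrically convergent series.\<close>

lemma control_points_exist: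
  fixes c :: "'t \<Rightarrow> 'a::banach"
  assumes "finite B" and j: "\<And>A. A \<in> B \<Longrightarrow> j A \<in> B" and \<beta>: "\<bar>\<beta>\<bar> > 1"
  obtains p where "\<And>A. A \<in> B \<Longrightarrow> p (j A) + c A = \<beta> *\<^sub>R p A"
proof
  \<comment> \<open>These are the terms obtained by unrolling
    \<open>p A = inverse \<beta> *\<^sub>R (c A + p (j A))\<close> along the orbit of
    \<open>A\<close> under \<open>j\<close>; the common outer factor is put into
    \<open>p\<close>.\<close>
  define a where "a = (\<lambda>A n. inverse \<beta> ^ n *\<^sub>R c ((j ^^ n) A))"
  define p where "p = (\<lambda>A. inverse \<beta> *\<^sub>R (\<Sum>n. a A n))"
  fix A assume A: "A \<in> B"
  have iter: "(j ^^ n) A \<in> B" for n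
    by (induction n) (use A j in auto)
  define K where "K = Max ((\<lambda>A. norm (c A)) ` B)"
  have bound: "norm (c ((j ^^ n) A)) \<le> K" for n
    unfolding K_def using iter \<open>finite B\<close> by (intro Max_ge) auto
  have "summable (a A)"
  proof (rule summable_comparison_test')
    show "summable (\<lambda>n. \<bar>inverse \<beta>\<bar> ^ n * K)"
      using \<beta> by (intro summable_mult2 summable_geometric) (simp add: field_simps)
    show "norm (a A n) \<le> \<bar>inverse \<beta>\<bar> ^ n * K" if "n \<ge> 0" for n
      unfolding a_def using bound by (simp add: power_abs mult_left_mono del: abs_inverse power_inverse)
  qed
  moreover have a_Suc: "a A (Suc n) = inverse \<beta> *\<^sub>R a (j A) n" for n
    by (simp add: a_def funpow_swap1)
  ultimately have "summable (\<lambda>n. inverse \<beta> *\<^sub>R a (j A) n)"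
    using summable_Suc_iff[of "a A"] unfolding a_Suc by simp
  then have "summable (a (j A))"
    using summable_scaleR_right[of "\<lambda>n. inverse \<beta> *\<^sub>R a (j A) n" \<beta>] \<beta> by auto
  then have "(\<Sum>n. a A (Suc n)) = p (j A)"
    unfolding a_Suc p_def by (rule suminf_scaleR_right[symmetric])
  moreover have "(\<Sum>n. a A n) = (\<Sum>n. a A (Suc n)) + c A"
    using suminf_split_head[OF \<open>summable (a A)\<close>] by (simp add: a_def)
  ultimately show "p (j A) + c A = \<beta> *\<^sub>R p A"
    using \<beta> by (auto simp: p_def)
qed

theorem theorem3p1:
  fixes B :: "(real^'d, 'l::finite) tile set"
    and \<phi> :: "real^'d \<Rightarrow> real^'d"
    and \<rho> :: "(real^'d, 'l) tile \<Rightarrow> (real^'d, 'l) tile set"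
    and \<beta> :: real
    and \<T> :: "(real^'d, 'l) tile set"
  assumes "overlapping_substitution B \<phi> \<rho>"
    and "\<bar>\<beta>\<bar> > 1"
    and "\<And>x. \<phi> x = \<beta> *\<^sub>R x"
    and "is_tiling \<T>"
    and "\<T> \<subseteq> translates_of B"
    and "subst_pattern B \<phi> \<rho> \<T> = \<T>"
    and "finite_local_complexity \<T>"
    and "repetitive \<T>"
  shows "algebraic_int \<beta>"
proof -
  have finB: "finite B" and tileB: "\<And>A. A \<in> B \<Longrightarrow> is_tile A"
    and \<rho>: "\<And>A. A \<in> B \<Longrightarrow> \<rho> A \<noteq> {} \<and> \<rho> A \<subseteq> translates_of B"
    using assms(1) unfolding overlapping_substitution_def pre_overlapping_substitution_def by blast+
  have "\<exists>A' x. A' \<in> B \<and> translate x A' \<in> \<rho> A" if "A \<in> B" for A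
    using \<rho>[OF that] unfolding translates_of_def by blast
  then obtain j c where child: "\<And>A. A \<in> B \<Longrightarrow> j A \<in> B \<and> translate (c A) (j A) \<in> \<rho> A"
    by metis
  then obtain p where p: "\<And>A. A \<in> B \<Longrightarrow> p (j A) + c A = \<beta> *\<^sub>R p A"
    using control_points_exist[OF finB _ assms(2), of j c] by metis
  define X where "X = tile_reps B \<T>"
  define tl where "tl = (\<lambda>(x, A). translate x A :: (real^'d, 'l) tile)"
  define h where "h = (\<lambda>(x, A). x + p A)"
  have X_B: "snd r \<in> B" if "r \<in> X" for r
    using that by (auto simp: X_def tile_reps_def)
  \<comment> \<open>The chosen child of the tile at x has position c A + \<beta> x, so its control
    point is \<beta> x + c A + p (j A) = \<beta> (x + p A). It lies in \<T> because \<T> is fixed by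
    the substitution.\<close>
  have h_child: "\<exists>r'\<in>X. h r' = \<beta> *\<^sub>R h r" if "r \<in> X" for r
  proof -
    obtain x A where r: "r = (x, A)" "A \<in> B" "translate x A \<in> \<T>"
      using \<open>r \<in> X\<close> by (auto simp: X_def tile_reps_def)
    have "translate (\<phi> x) (translate (c A) (j A)) \<in> subst_tile B \<phi> \<rho> (translate x A)"
      unfolding subst_tile_def using child r(2) by blast
    then have "translate (c A + \<phi> x) (j A) \<in> \<T>"
      using assms(6) r(3) unfolding subst_pattern_def translate_translate by blast
    then have "(c A + \<phi> x, j A) \<in> X"
      using child r(2) by (simp add: X_def tile_reps_def)
    moreover have "h (c A + \<phi> x, j A) = \<beta> *\<^sub>R h r"
      using p[OF r(2)] by (simp add: h_def r(1) assms(3) scaleR_add_right algebra_simps)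
    ultimately show ?thesis
      by blast
  qed
  have cover: "\<exists>r\<in>X. y \<in> supp (tl r)" for y
  proof -
    obtain T where T: "T \<in> \<T>" "y \<in> supp T"
      using assms(4) unfolding is_tiling_def pattern_supp_def by blast
    obtain x A where "T = translate x A" "A \<in> B"
      using T(1) assms(5) unfolding translates_of_def by blast
    with T show ?thesis
      by (intro bexI[of _ "(x, A)"]) (auto simp: X_def tile_reps_def tl_def)
  qed
  have "bounded (\<Union>A\<in>B. supp A)"
    using finB tileB by (auto simp: is_tile_def compact_imp_bounded)
  then obtain D where D: "D > 0" "(\<Union>A\<in>B. supp A) \<subseteq> ball 0 D"
    using bounded_subset_ballD by blast
  have supp_ball: "supp (tl r) \<subseteq> ball (fst r) D" if "r \<in> X" for r
  proof
    fix y assume "y \<in> supp (tl r)"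
    then obtain s where "s \<in> supp (snd r)" "y = s + fst r"
      by (auto simp: tl_def supp_translate split: prod.splits)
    then show "y \<in> ball (fst r) D"
      using D(2) X_B[OF that] by (auto simp: dist_norm)
  qed
  \<comment> \<open>From the position of one tile to any point of the other: D to y, less than 1 to
    z, D to the second position, and D again.\<close>
  define R where "R = 3 * D + 1"
  define near where "near = (\<lambda>r r'. \<exists>c. supp (tl r) \<union> supp (tl r') \<subseteq> ball c R)"
  have nearI: "near r r'"
    if r: "r \<in> X" "r' \<in> X" and y: "y \<in> supp (tl r)" "z \<in> supp (tl r')" "dist y z < 1" for r r' y z
    unfolding near_def
  proof (intro exI subsetI)
    fix u assume u: "u \<in> supp (tl r) \<union> supp (tl r')"
    have 1: "dist (fst r) y < D" "dist (fst r') z < D"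
      using supp_ball[OF r(1)] supp_ball[OF r(2)] y by auto
    have "dist (fst r) u < D \<or> dist (fst r') u < D"
      using u supp_ball[OF r(1)] supp_ball[OF r(2)] by auto
    then show "u \<in> ball (fst r) R"
    proof
      assume "dist (fst r') u < D"
      moreover have "dist (fst r) u \<le> dist (fst r) y + dist y z + dist z (fst r') + dist (fst r') u"
        by metric
      ultimately show ?thesis
        using 1 y(3) unfolding R_def by (simp add: dist_commute)
    qed (use D(1) in \<open>simp add: R_def\<close>)
  qed
  \<comment> \<open>If all control points coincided, each proto-tile would occur in at most one
    position, and finitely many bounded tiles would cover the space.\<close>
  have "\<exists>r\<in>X. \<exists>r0\<in>X. h r \<noteq> h r0"
  proof (rule ccontr)
    assume "\<not> ?thesis"
    moreover obtain r0 where "r0 \<in> X"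
      using cover by blast
    ultimately have const: "h r = h r0" if "r \<in> X" for r
      using that by blast
    have "X \<subseteq> (\<lambda>A. (h r0 - p A, A)) ` B"
    proof (intro subsetI image_eqI)
      fix r assume "r \<in> X"
      then show "r = (h r0 - p (snd r), snd r)"
        using const[of r] by (simp add: h_def case_prod_beta prod_eq_iff algebra_simps)
    qed (rule X_B)
    then have "finite X"
      using finB finite_surj by blast
    moreover have "bounded (supp (tl r))" if "r \<in> X" for r
      using supp_ball[OF that] bounded_ball bounded_subset by blast
    ultimately have "bounded (\<Union>r\<in>X. supp (tl r))"
      by blast
    moreover have "(\<Union>r\<in>X. supp (tl r)) = UNIV"
      using cover by blast
    ultimately show False
      using not_bounded_UNIV by metis
  qed
  then obtain r1 r0 where r10: "r1 \<in> X" "r0 \<in> X" "h r1 \<noteq> h r0"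
    by blast
  \<comment> \<open>This functional takes h r1 - h r0 to its squared norm, which is nonzero, and
    moves the group of vectors into the reals.\<close>
  define f where "f = (\<lambda>x. inner x (h r1 - h r0))"
  have f_nz: "f (h r1) - f (h r0) \<noteq> 0"
    using r10(3) by (simp add: f_def flip: inner_diff_left)
  define S where "S = {f (h r) - f (h r') | r r'. r \<in> X \<and> r' \<in> X \<and> near r r'}"
  have "finite S"
  proof -
    let ?D = "{(A, C, x - y) | x y A C. (x, A) \<in> X \<and> (y, C) \<in> X \<and>
      (\<exists>c. supp (translate x A) \<union> supp (translate y C) \<subseteq> ball c R)}"
    have "R > 0"
      using D(1) by (simp add: R_def)
    then have "finite ?D"
      unfolding X_def using finite_relative_positions[OF finB tileB assms(7)] by blast
    \<comment> \<open>A difference of control points depends only on the two proto-tiles and the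
      relative position.\<close>
    moreover have "S \<subseteq> (\<lambda>(A, C, v). f (v + p A - p C)) ` ?D"
    proof
      fix s assume "s \<in> S"
      then obtain x A y C where s: "s = f (h (x, A)) - f (h (y, C))" "(x, A) \<in> X" "(y, C) \<in> X" "near (x, A) (y, C)"
        unfolding S_def by fast
      then have "(A, C, x - y) \<in> ?D"
        unfolding near_def tl_def by auto
      moreover have "s = f (x - y + p A - p C)"
        unfolding s(1) f_def h_def by (simp add: algebra_simps inner_diff_left inner_add_left)
      ultimately show "s \<in> (\<lambda>(A, C, v). f (v + p A - p C)) ` ?D"
        by (intro image_eqI[of _ _ "(A, C, x - y)"]) auto
    qed
    ultimately show ?thesis
      by (rule finite_surj)
  qed
  have span: "f (h r) - f (h r') \<in> int_span S" if r: "r \<in> X" "r' \<in> X" for r r'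
  proof -
    have near_span: "f (h q) - f (h r') \<in> int_span S"
      if "q \<in> X" "q' \<in> X" "near q q'" "f (h q') - f (h r') \<in> int_span S" for q q'
    proof -
      have "f (h q) - f (h q') \<in> S"
        unfolding S_def using that by blast
      from int_span_add[OF int_span_superset[OF \<open>finite S\<close> this] that(4)] show ?thesis
        by simp
    qed
    \<comment> \<open>The region covered by tiles whose control point differs from that of r' by an
      element of the group. Any tile meeting the unit ball around a point of \<open>U\<close> is
      near such a tile, hence is itself of this kind.\<close>
    define U where "U = {y. \<exists>q\<in>X. y \<in> supp (tl q) \<and> f (h q) - f (h r') \<in> int_span S}"
    have nonempty: "supp (tl q) \<noteq> {}" if "q \<in> X" for q
      using tileB[OF X_B[OF that]] by (auto simp: tl_def supp_translate is_tile_def split: prod.splits)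
    have "U = UNIV"
    proof (rule ball_closed_set_eq_UNIV)
      show "U \<noteq> {}"
        unfolding U_def using nonempty r(2) int_span_zero[of S] by fastforce
      fix y z assume "y \<in> U" "dist y z < 1"
      then obtain q' where q': "q' \<in> X" "y \<in> supp (tl q')" "f (h q') - f (h r') \<in> int_span S"
        unfolding U_def by blast
      obtain q where q: "q \<in> X" "z \<in> supp (tl q)"
        using cover by blast
      have "near q q'"
        using nearI q q' \<open>dist y z < 1\<close> by (metis dist_commute)
      then show "z \<in> U"
        unfolding U_def using near_span q q' by blast
    qed
    moreover obtain y where y: "y \<in> supp (tl r)"
      using nonempty r(1) by blast
    ultimately obtain q where q: "q \<in> X" "y \<in> supp (tl q)" "f (h q) - f (h r') \<in> int_span S"
      unfolding U_def by blast
    \<comment> \<open>The tile \<open>q\<close> witnessing y in \<open>U\<close> may differ from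
      \<open>r\<close>; since both contain y, one further step reaches \<open>r\<close>.\<close>
    have "near r q"
      using nearI[OF r(1) q(1) y q(2)] by simp
    then show ?thesis
      using near_span r(1) q by blast
  qed
  show ?thesis
  proof (rule algebraic_int_if_int_span_invariant[OF \<open>finite S\<close>])
    show "\<not> S \<subseteq> {0}"
      using span[OF r10(1,2)] f_nz int_span_subset_zero by blast
    fix s assume "s \<in> S"
    then obtain r r' where s: "s = f (h r) - f (h r')" "r \<in> X" "r' \<in> X"
      unfolding S_def by blast
    obtain q q' where q: "q \<in> X" "h q = \<beta> *\<^sub>R h r" "q' \<in> X" "h q' = \<beta> *\<^sub>R h r'"
      using h_child s by meson
    \<comment> \<open>The two children need not be near each other, but \<open>span\<close> covers
      differences of arbitrary pairs.\<close>
    have "\<beta> * s = f (h q) - f (h q')"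
      unfolding s(1) q f_def by (simp add: algebra_simps)
    then show "\<beta> * s \<in> int_span S"
      using span[OF q(1,3)] by simp
  qed
qed

end
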